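(* Let $\mathcal{H}=\{s\in\mathbb{C}:\operatorname{Re}(s)>1\}$, and for each $z\in\mathbb{C}$ let $D_z(s)=\sum_{n\in\mathbb{N}}G_z(n)n^{-s}$ be the Dirichlet series defined in the context. The family $\mathcal{D}=\{D_z(s):z\in\mathbb{C}\}$ has the following properties: (i) The Riemann zeta function belongs to $\mathcal{D}$. (ii) For every $z\in\mathbb{C}$, $D_z(s)=1/D_z^\dagger(s)$ is meromorphic and nonzero in $\mathcal{H}$. (iii) Only two series in $\mathcal{D}$ have an Euler product (i.e., a multiplicative coefficient function $G_z$), namely the Riemann zeta function and the constant function equal to $1$ for all $s\in\mathbb{C}$.
   Context: $\mathbb{N}$ denotes the set of positive integers. For an arithmetical function $F:\mathbb{N}\to\mathbb{C}$ with $F(1)\ne 0$, the Dirichlet inverse $\widetilde F$ is the arithmetical function determined by $\sum_{ab=n}F(a)\widetilde F(b)=I(n)$ for all $n\in\mathbb{N}$, where $I(1)=1$ and $I(n)=0$ for $n\ge 2$. For $z\in\mathbb{C}$, let $F_z(1)=1$ and $F_z(n)=-z$ for all $n\ge 2$, and let $\widetilde F_z$ be the Dirichlet inverse of $F_z$. Let $\mu$ be the M\"obius function. Put $D_z^\dagger(s)=\sum_{n\in\mathbb{N}}\widetilde F_z(n)\mu(n)^2n^{-s}$ and $D_z(s)=D_z^\dagger(s)^{-1}=\sum_{n\in\mathbb{N}}G_z(n)n^{-s}$, where $G_z$ is the Dirichlet inverse of the function $n\mapsto\widetilde F_z(n)\mu(n)^2$. The function $D_z(s)$ is regarded on $\mathcal{H}$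 as the reciprocal of the function $D_z^\dagger(s)$ (at a zero of $D_z^\dagger$ it has a pole). An arithmetical function $G$ is multiplicative if $G(1)=1$ and $G(mn)=G(m)G(n)$ whenever $\gcd(m,n)=1$. *)

theory Defs
  imports "HOL-Complex_Analysis.Complex_Analysis" "HOL-Computational_Algebra.Computational_Algebra"
begin

text \<open>
  Arithmetical functions are functions \<^typ>\<open>nat \<Rightarrow> complex\<close> of which only the values at
  positive arguments matter. Wherever such a function is constructed, its value at \<open>0\<close> is
  set to \<open>0\<close>, so that two of them are equal iff they agree on the positive integers.
\<close>

definition dirichlet_unit :: "nat \<Rightarrow> complex" where
  "dirichlet_unit n = (if n = 1 then 1 else 0)"

text \<open>Meaningful for \<open>F 1 \<noteq> 0\<close>.\<close>
definition dirichlet_inverse :: "(nat \<Rightarrow> complex) \<Rightarrow> nat \<Rightarrow> complex" where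
  "dirichlet_inverse F =
     (THE g. g 0 = 0 \<and> (\<forall>n>0. (\<Sum>(a, b) | a * b = n. F a * g b) = dirichlet_unit n))"

definition moebius_mu :: "nat \<Rightarrow> complex" where
  "moebius_mu n = (if squarefree n then (-1) ^ card (prime_factors n) else 0)"

definition is_multiplicative :: "(nat \<Rightarrow> complex) \<Rightarrow> bool" where
  "is_multiplicative G \<longleftrightarrow>
     G 1 = 1 \<and> (\<forall>m>0. \<forall>n>0. coprime m n \<longrightarrow> G (m * n) = G m * G n)"

text \<open>The \<open>k\<close>-th term of the series belongs to the positive integer \<open>Suc k\<close>.\<close>
definition dirichlet_term :: "(nat \<Rightarrow> complex) \<Rightarrow> complex \<Rightarrow> nat \<Rightarrow> complex" where
  "dirichlet_term f s k = f (Suc k) * of_nat (Suc k) powr (- s)"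

definition dirichlet_sum :: "(nat \<Rightarrow> complex) \<Rightarrow> complex \<Rightarrow> complex" where
  "dirichlet_sum f s = (\<Sum>k. dirichlet_term f s k)"

definition half_plane :: "complex set" where
  "half_plane = {s. Re s > 1}"

text \<open>The Riemann zeta function on \<^const>\<open>half_plane\<close>; no continuation is needed.\<close>
definition zeta :: "complex \<Rightarrow> complex" where
  "zeta = dirichlet_sum (\<lambda>n. 1)"

definition F :: "complex \<Rightarrow> nat \<Rightarrow> complex" where
  "F z n = (if n = 0 then 0 else if n = 1 then 1 else - z)"

definition D_dagger_coeff :: "complex \<Rightarrow> nat \<Rightarrow> complex" where
  "D_dagger_coeff z n = dirichlet_inverse (F z) n * (moebius_mu n)\<^sup>2"

definition D_dagger :: "complex \<Rightarrow> complex \<Rightarrow> complex" where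
  "D_dagger z = dirichlet_sum (D_dagger_coeff z)"

definition G :: "complex \<Rightarrow> nat \<Rightarrow> complex" where
  "G z = dirichlet_inverse (D_dagger_coeff z)"

text \<open>
  A Dirichlet series is kept as its coefficient function together with the function it is
  regarded as, because \<open>D z\<close> is used on all of \<^const>\<open>half_plane\<close> as the reciprocal of
  \<^const>\<open>D_dagger\<close>, also where the series with coefficients \<^const>\<open>G\<close> \<open>z\<close> need not converge.
  As \<open>inverse 0 = 0\<close>, the value at a zero of \<^const>\<open>D_dagger\<close> \<open>z\<close> is the dummy \<open>0\<close>.
\<close>
record dirichlet_series =
  coeff :: "nat \<Rightarrow> complex"
  fun_of :: "complex \<Rightarrow> complex"

definition D :: "complex \<Rightarrow> dirichlet_series" where
  "D z = \<lparr>coeff = G z, fun_of = (\<lambda>s. inverse (D_dagger z s))\<rparr>"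

definition D_family :: "dirichlet_series set" where
  "D_family = range D"

definition has_euler_product :: "dirichlet_series \<Rightarrow> bool" where
  "has_euler_product d \<longleftrightarrow> is_multiplicative (coeff d)"

definition is_zeta :: "dirichlet_series \<Rightarrow> bool" where
  "is_zeta d \<longleftrightarrow> (\<forall>n>0. coeff d n = 1) \<and> (\<forall>s\<in>half_plane. fun_of d s = zeta s)"

definition is_constant_one :: "dirichlet_series \<Rightarrow> bool" where
  "is_constant_one d \<longleftrightarrow> (\<forall>n>0. coeff d n = dirichlet_unit n) \<and> (\<forall>s. fun_of d s = 1)"

end

theory Submission
  imports Defs
begin

text \<open>
  Write \<open>\<omega>(n)\<close> for the number of prime factors of \<open>n\<close>. The Dirichlet inverse of \<open>F z\<close> at \<open>n\<close> is the sum of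
  \<open>z\<^sup>l\<close> over the ordered factorizations of \<open>n\<close> into \<open>l\<close> factors greater than 1, and on squarefree
  \<open>n\<close> it is the Fubini polynomial of index \<open>\<omega>(n)\<close> at \<open>z\<close>.

  The substance is the convergence of \<open>D_dagger z\<close> in the whole half plane for every \<open>z\<close>, although
  the coefficients contain \<open>\<omega>(n)!\<close>. For \<open>r > 0\<close> and \<open>q = r / (1 + r)\<close> the Fubini polynomial at \<open>r\<close> is, up
  to the factor \<open>1 + r\<close>, the series \<open>\<Sum>m. q\<^sup>m m\<^sup>k\<close> with \<open>k = \<omega>(n)\<close> (\<open>fubini_sum_proper_divisors\<close>,
  \<open>norm_F_inverse_le\<close>). Summing over squarefree \<open>n\<close> first gives for each \<open>m\<close> the Euler product of
  the factors \<open>1 + m x p\<close>, where \<open>x p\<close> is \<open>p\<close> to the power \<open>- \<sigma>\<close>. As the series of the \<open>x p\<close> converges for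
  \<open>\<sigma> > 1\<close>, this product grows subexponentially in \<open>m\<close>, so the geometric weight \<open>q\<^sup>m\<close> wins
  (\<open>prod_one_plus_le\<close>, \<open>summable_fubini_sum_squarefree\<close>).

  Absolute convergence makes \<open>D_dagger z\<close> holomorphic, and it is not identically zero because it tends to
  its first coefficient 1 far to the right (\<open>dirichlet_sum_nonzero\<close>). The reciprocal is therefore
  meromorphic, has its poles exactly at the zeros of \<open>D_dagger z\<close>, and has no zeros.

  For \<open>z = - 1\<close> the inverse of \<open>F z\<close> is the Moebius function, so \<open>G z\<close> is constantly 1 and the
  reciprocal is the zeta function. For \<open>z = 0\<close> everything is the unit of Dirichlet convolution.
  Conversely, \<open>G z\<close> takes the value \<open>- z\<close> at every prime and at every product of two distinct primes, so
  multiplicativity forces \<open>z\<^sup>2 = - z\<close> (\<open>G_multiplicative_imp\<close>).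
\<close>

section \<open>Dirichlet inverses\<close>

lemma sum_dirichlet_pairs:
  fixes f g :: "nat \<Rightarrow> 'a::comm_semiring_1"
  assumes "n > 0"
  shows "(\<Sum>(a, b) | a * b = n. f a * g b) = (\<Sum>d | d dvd n. f (n div d) * g d)"
  by (rule sum.reindex_bij_witness[of _ "\<lambda>d. (n div d, d)" snd]) (use assms in auto)

lemma sum_divisors_split:
  fixes h :: "nat \<Rightarrow> 'a::comm_monoid_add"
  assumes "n > 0"
  shows "(\<Sum>d | d dvd n. h d) = h n + (\<Sum>d | d dvd n \<and> d < n. h d)"
proof -
  have "{d. d dvd n} = insert n {d. d dvd n \<and> d < n}"
    using assms by (auto dest: dvd_imp_le)
  then show ?thesis using assms by simp
qed

text \<open>
  Solving the defining convolution identity for its term of largest index gives the inverse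
  by recursion along divisibility; this provides the existence that the definite description
  of the Dirichlet inverse presupposes.
\<close>
function dirichlet_inverse_rec :: "(nat \<Rightarrow> complex) \<Rightarrow> nat \<Rightarrow> complex" where
  "dirichlet_inverse_rec f n = (if n = 0 then 0 else
     (dirichlet_unit n - (\<Sum>d | d dvd n \<and> d < n. f (n div d) * dirichlet_inverse_rec f d)) / f 1)"
  by auto
termination
  by (relation "Wellfounded.measure snd") auto

declare dirichlet_inverse_rec.simps [simp del]

lemma dirichlet_inverse_unique:
  assumes "f 1 \<noteq> 0" "g 0 = 0" "h 0 = 0"
    and g: "\<And>n. n > 0 \<Longrightarrow> (\<Sum>(a, b) | a * b = n. f a * g b) = dirichlet_unit n"
    and h: "\<And>n. n > 0 \<Longrightarrow> (\<Sum>(a, b) | a * b = n. f a * h b) = dirichlet_unit n"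
  shows "g = h"
proof
  fix n
  show "g n = h n"
  proof (induction n rule: less_induct)
    case (less n)
    show ?case
    proof (cases "n = 0")
      case False
      then have n: "n > 0" by simp
      have "f 1 * g n + (\<Sum>d | d dvd n \<and> d < n. f (n div d) * g d)
          = f 1 * h n + (\<Sum>d | d dvd n \<and> d < n. f (n div d) * h d)"
        using g[OF n] h[OF n] n by (simp add: sum_dirichlet_pairs sum_divisors_split)
      moreover have "(\<Sum>d | d dvd n \<and> d < n. f (n div d) * g d)
          = (\<Sum>d | d dvd n \<and> d < n. f (n div d) * h d)"
        by (rule sum.cong) (auto simp: less.IH)
      ultimately show ?thesis using assms(1) by simp
    qed (use assms in simp)
  qed
qed

lemma dirichlet_inverse_eqI:
  assumes "f 1 \<noteq> 0" "g 0 = 0"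
    and "\<And>n. n > 0 \<Longrightarrow> (\<Sum>(a, b) | a * b = n. f a * g b) = dirichlet_unit n"
  shows "dirichlet_inverse f = g"
  unfolding dirichlet_inverse_def
proof (rule the_equality)
  fix h assume "h 0 = 0 \<and> (\<forall>n>0. (\<Sum>(a, b) | a * b = n. f a * h b) = dirichlet_unit n)"
  then show "h = g" using dirichlet_inverse_unique[of f h g] assms by blast
qed (use assms in auto)

lemma dirichlet_inverse_eq_rec:
  assumes "f 1 \<noteq> 0"
  shows "dirichlet_inverse f = dirichlet_inverse_rec f"
proof (rule dirichlet_inverse_eqI)
  show "dirichlet_inverse_rec f 0 = 0" by (simp add: dirichlet_inverse_rec.simps)
  show "(\<Sum>(a, b) | a * b = n. f a * dirichlet_inverse_rec f b) = dirichlet_unit n" if "n > 0" for n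
    using that assms dirichlet_inverse_rec.simps[of f n]
    by (simp add: sum_dirichlet_pairs sum_divisors_split)
qed fact

lemma dirichlet_inverse_pos:
  assumes "f 1 \<noteq> 0" "n > 0"
  shows "dirichlet_inverse f n =
    (dirichlet_unit n - (\<Sum>d | d dvd n \<and> d < n. f (n div d) * dirichlet_inverse f d)) / f 1"
  using assms by (simp add: dirichlet_inverse_eq_rec dirichlet_inverse_rec.simps[of f n])

lemma dirichlet_inverse_1: "f 1 \<noteq> 0 \<Longrightarrow> dirichlet_inverse f 1 = 1 / f 1"
  by (simp add: dirichlet_inverse_pos dirichlet_unit_def)

text \<open>
  Dirichlet convolution is commutative, so the defining identity is symmetric in both
  functions. The condition \<open>f 0 = 0\<close> is the normalisation of an inverse at \<open>0\<close>.
\<close>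
lemma dirichlet_inverse_dirichlet_inverse:
  assumes "f 1 \<noteq> 0" "f 0 = 0"
  shows "dirichlet_inverse (dirichlet_inverse f) = f"
proof (rule dirichlet_inverse_eqI)
  show "dirichlet_inverse f 1 \<noteq> 0"
    using dirichlet_inverse_1[of f] assms by simp
next
  fix n :: nat assume n: "n > 0"
  have "(\<Sum>(a, b) | a * b = n. dirichlet_inverse f a * f b)
      = (\<Sum>(a, b) | a * b = n. f a * dirichlet_inverse f b)"
    by (rule sum.reindex_bij_witness[of _ prod.swap prod.swap]) (auto simp: mult.commute)
  also have "\<dots> = dirichlet_unit n"
    using n assms(1) dirichlet_inverse_pos[of f n]
    by (simp add: sum_dirichlet_pairs sum_divisors_split)
  finally show "(\<Sum>(a, b) | a * b = n. dirichlet_inverse f a * f b) = dirichlet_unit n" .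
qed fact

lemma dirichlet_inverse_prime:
  assumes "f 1 = 1" "prime p"
  shows "dirichlet_inverse f p = - f p"
proof -
  have "{d. d dvd p \<and> d < p} = {1}"
    using assms(2) by (auto simp: prime_nat_iff)
  then show ?thesis using assms prime_gt_1_nat[OF assms(2)]
    by (simp add: dirichlet_inverse_pos dirichlet_inverse_1[unfolded One_nat_def] dirichlet_unit_def)
qed

lemma dirichlet_inverse_prime_mult_prime:
  assumes "f 1 = 1" "prime p" "prime q" "p \<noteq> q"
  shows "dirichlet_inverse f (p * q) = 2 * f p * f q - f (p * q)"
proof -
  have pq: "p > 1" "q > 1" using assms prime_gt_1_nat by auto
  have "d \<in> {1, p, q, p * q}" if "d dvd p * q" for d
  proof -
    from that obtain a b where ab: "d = a * b" "a dvd p" "b dvd q"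
      using division_decomp by blast
    then have "a \<in> {1, p}" "b \<in> {1, q}" using assms by (auto simp: prime_nat_iff)
    then show ?thesis using ab by auto
  qed
  moreover have "1 < p * q" using pq by (rule less_1_mult)
  ultimately have "{d. d dvd p * q \<and> d < p * q} = {1, p, q}"
    using pq by auto
  then show ?thesis using assms pq dirichlet_inverse_pos[of f "p * q"]
    by (simp add: dirichlet_inverse_1[unfolded One_nat_def]
        dirichlet_inverse_prime dirichlet_unit_def)
qed

section \<open>Squarefree numbers and sets of primes\<close>

lemma prod_prime_factors_squarefree:
  fixes n :: nat
  assumes "squarefree n"
  shows "\<Prod>(prime_factors n) = n"
proof -
  have n: "n \<noteq> 0" using assms by (metis not_squarefree_0)
  have "(\<Prod>p\<in>prime_factors n. p) = (\<Prod>p\<in>prime_factors n. p ^ multiplicity p n)"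
    using squarefree_factorial_semiring'[OF n] assms by (intro prod.cong) auto
  also have "\<dots> = n" using n prime_factorization_nat[of n] by (metis bot_nat_0.not_eq_extremum)
  finally show ?thesis by simp
qed

lemma inj_on_prime_factors_squarefree: "inj_on prime_factors {n::nat. squarefree n}"
  by (metis (mono_tags, lifting) inj_onI mem_Collect_eq prod_prime_factors_squarefree)

lemma
  fixes S :: "nat set"
  assumes "finite S" "\<And>p. p \<in> S \<Longrightarrow> prime p"
  shows prime_factors_prod_primes: "prime_factors (\<Prod>S) = S"
    and squarefree_prod_primes: "squarefree (\<Prod>S)"
proof -
  show "prime_factors (\<Prod>S) = S"
    using assms by (subst prime_factors_prod) (auto simp: prime_prime_factors dest: not_prime_0[THEN notE])
  show "squarefree (\<Prod>S)"
    by (rule squarefree_prod_coprime)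
       (use assms in \<open>auto intro: primes_coprime squarefree_prime\<close>)
qed

text \<open>
  Taking prime factors turns squarefree divisors into subsets of a finite set, so that sums
  over them become expansions of products.
\<close>
lemma bij_betw_squarefree_divisors:
  assumes "n > (0::nat)"
  shows "bij_betw prime_factors {d. d dvd n \<and> squarefree d} (Pow (prime_factors n))"
  unfolding bij_betw_def
proof
  show "inj_on prime_factors {d. d dvd n \<and> squarefree d}"
    by (rule inj_on_subset[OF inj_on_prime_factors_squarefree]) auto
  show "prime_factors ` {d. d dvd n \<and> squarefree d} = Pow (prime_factors n)"
  proof
    show "prime_factors ` {d. d dvd n \<and> squarefree d} \<subseteq> Pow (prime_factors n)"
      using assms by (auto dest: dvd_prime_factors[rotated])
    show "Pow (prime_factors n) \<subseteq> prime_factors ` {d. d dvd n \<and> squarefree d}"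
    proof
      fix S assume "S \<in> Pow (prime_factors n)"
      then have S: "S \<subseteq> prime_factors n" by simp
      then have fin: "finite S" and pr: "\<And>p. p \<in> S \<Longrightarrow> prime p"
        by (auto intro: finite_subset)
      have "\<Prod>S dvd \<Prod>(prime_factors n)"
        by (rule prod_dvd_prod_subset) (use S in auto)
      also have "\<dots> dvd (\<Prod>p\<in>prime_factors n. p ^ multiplicity p n)"
        by (rule prod_dvd_prod) (auto simp: prime_factors_multiplicity)
      also have "\<dots> = n" using assms prime_factorization_nat[of n] by simp
      finally have "\<Prod>S \<in> {d. d dvd n \<and> squarefree d}"
        using squarefree_prod_primes[OF fin pr] by simp
      then show "S \<in> prime_factors ` {d. d dvd n \<and> squarefree d}"
        using prime_factors_prod_primes[OF fin pr] by blast
    qed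
  qed
qed

text \<open>
  For \<open>w = - 1\<close> this is Moebius inversion of the constant function 1; for a natural number
  \<open>w\<close> it is what makes the bound on the coefficients below reproduce itself.
\<close>
lemma sum_squarefree_divisors_power_card:
  fixes w :: "'a::comm_semiring_1"
  assumes "n > (0::nat)"
  shows "(\<Sum>d | d dvd n \<and> squarefree d. w ^ card (prime_factors d)) = (w + 1) ^ card (prime_factors n)"
proof -
  have "(\<Sum>d | d dvd n \<and> squarefree d. w ^ card (prime_factors d))
      = (\<Sum>S\<in>Pow (prime_factors n). w ^ card S)"
    by (rule sum.reindex_bij_betw[OF bij_betw_squarefree_divisors[OF assms]])
  also have "\<dots> = (\<Prod>p\<in>prime_factors n. w + 1)"
    by (subst prod_add) auto
  finally show ?thesis by simp
qed

section \<open>Absolutely convergent Dirichlet series in the half plane\<close>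

definition abs_convergent_on_half_plane :: "(nat \<Rightarrow> complex) \<Rightarrow> bool" where
  "abs_convergent_on_half_plane f \<longleftrightarrow>
     (\<forall>\<sigma>>1. summable (\<lambda>k. norm (f (Suc k)) * real (Suc k) powr (- \<sigma>)))"

lemma norm_dirichlet_term:
  "norm (dirichlet_term f s k) = norm (f (Suc k)) * real (Suc k) powr (- Re s)"
  unfolding dirichlet_term_def norm_mult
  by (subst norm_powr_real_powr) (auto simp del: of_nat_Suc)

lemma summable_norm_dirichlet_term:
  assumes "abs_convergent_on_half_plane f" "s \<in> half_plane"
  shows "summable (\<lambda>k. norm (dirichlet_term f s k))"
  using assms unfolding abs_convergent_on_half_plane_def half_plane_def norm_dirichlet_term by auto

lemma summable_dirichlet_term:
  assumes "abs_convergent_on_half_plane f" "s \<in> half_plane"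
  shows "summable (dirichlet_term f s)"
  using summable_norm_dirichlet_term[OF assms] by (rule summable_norm_cancel)

lemma open_half_plane: "open half_plane"
  unfolding half_plane_def by (rule open_halfspace_Re_gt)

lemma connected_half_plane: "connected half_plane"
  unfolding half_plane_def by (intro convex_connected convex_halfspace_Re_gt)

lemma dirichlet_sum_holomorphic:
  assumes "abs_convergent_on_half_plane f"
  shows "dirichlet_sum f holomorphic_on half_plane"
proof (rule holomorphic_uniform_sequence[OF open_half_plane])
  show "(\<lambda>s. \<Sum>k<N. dirichlet_term f s k) holomorphic_on half_plane" for N
    unfolding dirichlet_term_def by (intro holomorphic_intros) (auto simp del: of_nat_Suc)
next
  fix s assume "s \<in> half_plane"
  then have s: "Re s > 1" by (simp add: half_plane_def)
  define d where "d = (Re s - 1) / 2"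
  have d: "d > 0" "1 < Re s - d" using s by (auto simp: d_def field_simps)
  have Re: "Re s - d \<le> Re t" if "t \<in> cball s d" for t
    using that abs_Re_le_cmod[of "s - t"] by (simp add: dist_norm)
  have "uniform_limit (cball s d) (\<lambda>N t. \<Sum>k<N. dirichlet_term f t k) (dirichlet_sum f) sequentially"
    unfolding dirichlet_sum_def
  proof (rule Weierstrass_m_test)
    show "norm (dirichlet_term f t k) \<le> norm (f (Suc k)) * real (Suc k) powr (- (Re s - d))"
      if "t \<in> cball s d" for k t
      unfolding norm_dirichlet_term using Re[OF that]
      by (intro mult_left_mono powr_mono) auto
    show "summable (\<lambda>k. norm (f (Suc k)) * real (Suc k) powr (- (Re s - d)))"
      using assms d unfolding abs_convergent_on_half_plane_def by blast
  qed
  moreover have "cball s d \<subseteq> half_plane"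
    using Re d by (force simp: half_plane_def)
  ultimately show "\<exists>d>0. cball s d \<subseteq> half_plane \<and>
      uniform_limit (cball s d) (\<lambda>N t. \<Sum>k<N. dirichlet_term f t k) (dirichlet_sum f) sequentially"
    using d by blast
qed

text \<open>
  Far to the right the series is dominated by its first term: at \<open>s = 2 + n\<close> the remaining
  terms are at most \<open>2\<close> to the power \<open>- n\<close> times their absolute values at \<open>s = 2\<close>.
\<close>
lemma dirichlet_sum_nonzero:
  assumes f: "abs_convergent_on_half_plane f" and "f 1 \<noteq> 0"
  shows "\<exists>s\<in>half_plane. dirichlet_sum f s \<noteq> 0"
proof (rule ccontr)
  assume "\<not> ?thesis"
  then have zero: "dirichlet_sum f s = 0" if "s \<in> half_plane" for s using that by blast
  define c where "c k = norm (f (Suc (Suc k))) * real (Suc (Suc k)) powr (- 2)" for k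
  have "summable (\<lambda>k. norm (f (Suc k)) * real (Suc k) powr (- 2))"
    using f unfolding abs_convergent_on_half_plane_def by simp
  then have c: "summable c"
    unfolding c_def by (subst (asm) summable_Suc_iff [symmetric]) 
  have bound: "norm (f 1) \<le> (1/2) ^ n * suminf c" for n
  proof -
    define s where "s = complex_of_real (2 + real n)"
    have s: "s \<in> half_plane" by (simp add: s_def half_plane_def)
    note sums = summable_norm_dirichlet_term[OF f s] summable_dirichlet_term[OF f s]
    have le: "norm (dirichlet_term f s (Suc k)) \<le> (1/2) ^ n * c k" for k
    proof -
      have "real (Suc (Suc k)) powr (- (2 + real n))
          = real (Suc (Suc k)) powr (- 2) * (1 / real (Suc (Suc k))) ^ n"
        by (simp add: powr_diff powr_realpow power_divide)
      also have "\<dots> \<le> real (Suc (Suc k)) powr (- 2) * (1/2) ^ n"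
        by (intro mult_left_mono power_mono) (auto simp: field_simps)
      finally have "norm (f (Suc (Suc k))) * real (Suc (Suc k)) powr (- (2 + real n))
          \<le> norm (f (Suc (Suc k))) * (real (Suc (Suc k)) powr (- 2) * (1/2) ^ n)"
        by (intro mult_left_mono) auto
      then show ?thesis unfolding norm_dirichlet_term c_def by (simp add: s_def mult_ac)
    qed
    have "dirichlet_term f s 0 = f 1" by (simp add: dirichlet_term_def)
    then have "0 = f 1 + (\<Sum>k. dirichlet_term f s (Suc k))"
      using zero[OF s] suminf_split_head[OF sums(2)] by (simp add: dirichlet_sum_def)
    then have "norm (f 1) = norm (\<Sum>k. dirichlet_term f s (Suc k))"
      by (metis add.inverse_unique norm_minus_cancel)
    also have "\<dots> \<le> (\<Sum>k. norm (dirichlet_term f s (Suc k)))"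
      by (rule summable_norm) (use sums(1) in \<open>subst summable_Suc_iff\<close>)
    also have "\<dots> \<le> (\<Sum>k. (1/2) ^ n * c k)"
    proof (rule suminf_le[OF le])
      show "summable (\<lambda>k. norm (dirichlet_term f s (Suc k)))"
        using sums(1) by (subst summable_Suc_iff)
      show "summable (\<lambda>k. (1/2) ^ n * c k)" using c by (rule summable_mult)
    qed
    also have "\<dots> = (1/2) ^ n * suminf c" using c by (rule suminf_mult)
    finally show ?thesis .
  qed
  have "(\<lambda>n. (1/2) ^ n * suminf c) \<longlonglongrightarrow> 0"
    by (rule tendsto_mult_left_zero) (rule LIMSEQ_power_zero, simp)
  then have "norm (f 1) \<le> 0"
    by (rule LIMSEQ_le_const) (use bound in auto)
  then show False using assms by simp
qed

text \<open>
  The double series of all products of terms converges absolutely, so it may be summed along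
  the fibres of multiplication, where it gives the Dirichlet convolution.
\<close>
lemma dirichlet_sum_mult_inverse:
  assumes f: "abs_convergent_on_half_plane f" and g: "abs_convergent_on_half_plane g"
    and conv: "\<And>n. n > 0 \<Longrightarrow> (\<Sum>(a, b) | a * b = n. f a * g b) = dirichlet_unit n"
    and s: "s \<in> half_plane"
  shows "dirichlet_sum f s * dirichlet_sum g s = 1"
proof -
  define u v where "u = dirichlet_term f s" and "v = dirichlet_term g s"
  have u: "(u has_sum dirichlet_sum f s) UNIV" and v: "(v has_sum dirichlet_sum g s) UNIV"
    using f g s unfolding u_def v_def dirichlet_sum_def
    by (auto intro!: norm_summable_imp_has_sum summable_sums summable_dirichlet_term
        summable_norm_dirichlet_term)
  have un: "(\<lambda>k. norm (u k)) summable_on UNIV" and vn: "(\<lambda>k. norm (v k)) summable_on UNIV"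
    using f g s unfolding u_def v_def
    by (auto simp: summable_on_UNIV_nonneg_real_iff intro: summable_norm_dirichlet_term)
  have "(\<lambda>p. norm (case p of (j, k) \<Rightarrow> u j * v k)) summable_on UNIV \<times> UNIV"
  proof (rule summable_on_SigmaI)
    show "((\<lambda>k. norm (case (j, k) of (j, k) \<Rightarrow> u j * v k))
        has_sum norm (u j) * (\<Sum>\<^sub>\<infinity>k. norm (v k))) UNIV" for j
      using has_sum_cmult_right[OF has_sum_infsum[OF vn]] by (simp add: norm_mult)
    show "(\<lambda>j. norm (u j) * (\<Sum>\<^sub>\<infinity>k. norm (v k))) summable_on UNIV"
      by (rule summable_on_cmult_left[OF un])
  qed simp
  then have prod_summable: "(\<lambda>(j, k). u j * v k) summable_on UNIV \<times> UNIV"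
    by (rule abs_summable_summable)
  have total: "((\<lambda>(j, k). u j * v k) has_sum (dirichlet_sum f s * dirichlet_sum g s)) (UNIV \<times> UNIV)"
  proof (rule has_sum_SigmaI[OF _ _ prod_summable])
    show "((\<lambda>k. case (j, k) of (j, k) \<Rightarrow> u j * v k) has_sum u j * dirichlet_sum g s) UNIV" for j
      using has_sum_cmult_right[OF v] by simp
    show "((\<lambda>j. u j * dirichlet_sum g s) has_sum dirichlet_sum f s * dirichlet_sum g s) UNIV"
      by (rule has_sum_cmult_left[OF u])
  qed
  define fibre where "fibre n = {(j, k). Suc j * Suc k = Suc n}" for n
  \<comment> \<open>Note \<open>Suc j * Suc k = Suc (j + k + j * k)\<close>.\<close>
  have "((\<lambda>(n, j, k). u j * v k) has_sum (dirichlet_sum f s * dirichlet_sum g s)) (Sigma UNIV fibre)"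
    using total
    by (subst has_sum_reindex_bij_witness[of _ "\<lambda>(j, k). (j + k + j * k, j, k)" snd])
       (auto simp: fibre_def)
  moreover have "((\<lambda>p. case (n, p) of (n, j, k) \<Rightarrow> u j * v k) has_sum dirichlet_unit (Suc n)) (fibre n)" for n
  proof -
    have factors: "\<exists>j k. a = Suc j \<and> b = Suc k \<and> n = j + k + j * k"
      if "a * b = Suc n" for a b
      using that by (cases a; cases b) auto
    have "(\<Sum>(j, k)\<in>fibre n. u j * v k)
        = (\<Sum>(a, b) | a * b = Suc n. (f a * g b) * of_nat (Suc n) powr (- s))"
    proof (rule sum.reindex_bij_witness[of _ "\<lambda>(a, b). (a - 1, b - 1)" "\<lambda>(j, k). (Suc j, Suc k)"])
      fix p assume p: "p \<in> fibre n"
      obtain j k where jk: "p = (j, k)" by force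
      then have "Suc n = Suc j * Suc k" using p by (simp add: fibre_def)
      then have "of_nat (Suc n) powr (- s) = of_nat (Suc j) powr (- s) * of_nat (Suc k) powr (- s)"
        by (simp only: of_nat_mult) (rule powr_times_real, auto simp del: of_nat_Suc)
      then show "(case (case p of (j, k) \<Rightarrow> (Suc j, Suc k)) of (a, b) \<Rightarrow>
          (f a * g b) * of_nat (Suc n) powr (- s)) = (case p of (j, k) \<Rightarrow> u j * v k)"
        by (simp only: jk u_def v_def dirichlet_term_def prod.case mult_ac)
    qed (auto simp: fibre_def dest!: factors)
    also have "\<dots> = (\<Sum>(a, b) | a * b = Suc n. f a * g b) * of_nat (Suc n) powr (- s)"
      by (simp add: sum_distrib_right case_prod_unfold)
    also have "\<dots> = dirichlet_unit (Suc n)" using conv[of "Suc n"]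
      by (simp add: dirichlet_unit_def)
    finally have eq: "(\<Sum>(j, k)\<in>fibre n. u j * v k) = dirichlet_unit (Suc n)" .
    have "fibre n \<subseteq> {..n} \<times> {..n}" by (auto simp: fibre_def)
    then have "finite (fibre n)" by (rule finite_subset) auto
    from has_sum_finite[OF this, of "\<lambda>(j, k). u j * v k"] show ?thesis
      by (simp add: eq)
  qed
  ultimately have "((\<lambda>n. dirichlet_unit (Suc n)) has_sum (dirichlet_sum f s * dirichlet_sum g s)) UNIV"
    by (rule has_sum_SigmaD)
  moreover have "((\<lambda>n. dirichlet_unit (Suc n)) has_sum 1) UNIV"
    by (rule has_sum_finite_neutralI[of "{0}"]) (auto simp: dirichlet_unit_def)
  ultimately show ?thesis by (rule has_sum_unique)
qed

text \<open>
  Since the half plane is connected and the series does not vanish identically, its zeros are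
  isolated. Hence every zero is a pole of the reciprocal, and the dummy value \<open>inverse 0 = 0\<close>
  occurs at poles only.
\<close>
lemma inverse_dirichlet_sum_meromorphic:
  assumes "abs_convergent_on_half_plane f" "f 1 \<noteq> 0"
  shows "(\<lambda>s. inverse (dirichlet_sum f s)) nicely_meromorphic_on half_plane"
    and "s \<in> half_plane \<Longrightarrow> \<not> is_pole (\<lambda>s. inverse (dirichlet_sum f s)) s \<Longrightarrow>
      inverse (dirichlet_sum f s) \<noteq> 0"
proof -
  have hol: "dirichlet_sum f holomorphic_on half_plane"
    by (rule dirichlet_sum_holomorphic[OF assms(1)])
  then have an: "dirichlet_sum f analytic_on half_plane"
    by (simp add: analytic_on_open open_half_plane)
  then show "(\<lambda>s. inverse (dirichlet_sum f s)) nicely_meromorphic_on half_plane"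
    by (intro nicely_meromorphic_on_inverse analytic_on_imp_nicely_meromorphic_on)
  assume s: "s \<in> half_plane" and np: "\<not> is_pole (\<lambda>s. inverse (dirichlet_sum f s)) s"
  obtain t where t: "t \<in> half_plane" "dirichlet_sum f t \<noteq> 0"
    using dirichlet_sum_nonzero[OF assms] by blast
  have "eventually (\<lambda>w. dirichlet_sum f w \<noteq> 0) (at s)"
    using non_zero_neighbour_alt[OF hol open_half_plane connected_half_plane s t]
    by (auto elim: eventually_mono)
  moreover have "isCont (dirichlet_sum f) s"
    using analytic_at_imp_isCont an s analytic_on_analytic_at by blast
  ultimately show "inverse (dirichlet_sum f s) \<noteq> 0"
    using np unfolding is_pole_inverse_iff isolated_zero_def isCont_def by auto
qed

section \<open>Fubini sums\<close>

text \<open>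
  Differentiating a power series termwise multiplies its coefficients by a linear factor and
  preserves the radius of convergence.
\<close>
lemma summable_power_times_poly:
  fixes x :: real
  assumes "0 \<le> x" "x < 1"
  shows "summable (\<lambda>m. x ^ m * real (Suc m) ^ j)"
proof -
  have "summable (\<lambda>m. real (Suc m) ^ j * x ^ m)" if "norm x < 1" for x :: real
    using that
  proof (induction j arbitrary: x)
    case 0
    then show ?case by (simp add: summable_geometric)
  next
    case (Suc j)
    have "summable (\<lambda>m. diffs (\<lambda>m. real (Suc m) ^ j) m * norm x ^ m)"
      by (rule termdiff_converges[of _ 1]) (use Suc in auto)
    then show ?case
    proof (rule summable_comparison_test')
      fix m :: nat
      have "real (Suc m) * real (Suc m) ^ j \<le> real (Suc m) * real (Suc (Suc m)) ^ j"
        by (intro mult_left_mono power_mono) auto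
      then have "real (Suc m) * real (Suc m) ^ j * norm x ^ m
          \<le> real (Suc m) * real (Suc (Suc m)) ^ j * norm x ^ m"
        by (intro mult_right_mono) auto
      then show "norm (real (Suc m) ^ Suc j * x ^ m)
          \<le> diffs (\<lambda>m. real (Suc m) ^ j) m * norm x ^ m"
        by (simp add: diffs_def abs_mult power_abs del: of_nat_Suc)
    qed
  qed
  from this[of x] assms show ?thesis by (simp add: mult.commute)
qed

text \<open>
  With \<open>q = r / (1 + r)\<close> this is \<open>1 + r\<close> times the value at \<open>r\<close> of the \<open>k\<close>-th Fubini polynomial
  (the geometric polynomial \<open>\<Sum>j. j! S(k, j) r\<^sup>j\<close> with Stirling numbers \<open>S(k, j)\<close>). The series form
  is a mixture over \<open>m\<close> of the powers \<open>m\<^sup>k\<close>, and these are multiplicative functions of \<open>n\<close> when \<open>k\<close> is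
  the number of prime factors of \<open>n\<close>.
\<close>
definition fubini_sum :: "real \<Rightarrow> nat \<Rightarrow> real" where
  "fubini_sum q k = (\<Sum>m. q ^ m * real m ^ k)"

lemma summable_fubini_sum:
  assumes "0 \<le> q" "q < 1"
  shows "summable (\<lambda>m. q ^ m * real m ^ k)"
  by (rule summable_comparison_test'[OF summable_power_times_poly[OF assms, of k], of 0])
     (use assms in \<open>auto intro!: mult_left_mono power_mono simp: abs_mult\<close>)

lemma fubini_sum_nonneg:
  assumes "0 \<le> q" "q < 1"
  shows "0 \<le> fubini_sum q k"
  unfolding fubini_sum_def by (rule suminf_nonneg[OF summable_fubini_sum]) (use assms in auto)

lemma fubini_sum_0:
  assumes "0 \<le> q" "q < 1"
  shows "fubini_sum q 0 = 1 / (1 - q)"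
  unfolding fubini_sum_def using assms by (simp add: suminf_geometric)

text \<open>
  The recursion of the Dirichlet inverse of \<open>F r\<close> on squarefree numbers. Raising \<open>m\<close> to the
  number of prime factors of a divisor and summing over all divisors shifts \<open>m\<close> to \<open>m + 1\<close>, and
  shifting the index of the series back costs a factor \<open>1 / q\<close>; the choice of \<open>q\<close> is the one with \<open>r (1 / q - 1) = 1\<close>.
\<close>
lemma fubini_sum_proper_divisors:
  fixes r :: real and n :: nat
  assumes r: "r > 0" and n: "squarefree n" "n \<noteq> 1"
  defines "q \<equiv> r / (1 + r)"
  shows "r * (\<Sum>d | d dvd n \<and> d < n. fubini_sum q (card (prime_factors d)))
    = fubini_sum q (card (prime_factors n))"
proof -
  have q: "0 < q" "q < 1" using r by (auto simp: q_def field_simps)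
  then have q': "0 \<le> q" "q < 1" by auto
  have n0: "n > 0" using n by (metis not_squarefree_0 gr0I)
  define k where "k = card (prime_factors n)"
  have k: "k > 0" using n n0 unfolding k_def by (simp add: card_gt_0_iff prime_factorization_empty_iff)
  have divisors: "{d. d dvd n} = {d. d dvd n \<and> squarefree d}"
    using n(1) squarefree_mono by blast
  note sk = summable_fubini_sum[OF q', of k] and sk1 = summable_power_times_poly[OF q', of k]
  have "(\<Sum>d | d dvd n \<and> d < n. fubini_sum q (card (prime_factors d)))
      = (\<Sum>m. \<Sum>d | d dvd n \<and> d < n. q ^ m * real m ^ card (prime_factors d))"
    unfolding fubini_sum_def using q' by (intro suminf_sum[symmetric] summable_fubini_sum) auto
  also have "\<dots> = (\<Sum>m. q ^ m * real (Suc m) ^ k - q ^ m * real m ^ k)"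
  proof (intro suminf_cong)
    fix m
    have "(\<Sum>d | d dvd n. real m ^ card (prime_factors d)) = (real m + 1) ^ k"
      unfolding k_def divisors by (rule sum_squarefree_divisors_power_card[OF n0])
    then have "(\<Sum>d | d dvd n \<and> d < n. real m ^ card (prime_factors d))
        = real (Suc m) ^ k - real m ^ k"
      by (simp add: sum_divisors_split[OF n0] k_def add.commute)
    then show "(\<Sum>d | d dvd n \<and> d < n. q ^ m * real m ^ card (prime_factors d))
        = q ^ m * real (Suc m) ^ k - q ^ m * real m ^ k"
      by (simp only: sum_distrib_left[symmetric] right_diff_distrib)
  qed
  also have "\<dots> = (\<Sum>m. q ^ m * real (Suc m) ^ k) - fubini_sum q k"
    unfolding fubini_sum_def by (rule suminf_diff[OF sk1 sk, symmetric])
  also have "(\<Sum>m. q ^ m * real (Suc m) ^ k) = fubini_sum q k / q"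
  proof -
    have "fubini_sum q k = (\<Sum>m. q ^ Suc m * real (Suc m) ^ k)"
      unfolding fubini_sum_def using suminf_split_head[OF sk] k by simp
    also have "\<dots> = q * (\<Sum>m. q ^ m * real (Suc m) ^ k)"
      using suminf_mult[OF sk1, of q] by (simp add: mult_ac)
    finally show ?thesis using q by simp
  qed
  finally have "r * (\<Sum>d | d dvd n \<and> d < n. fubini_sum q (card (prime_factors d)))
      = r * (fubini_sum q k / q - fubini_sum q k)"
    by (simp only:)
  also have "\<dots> = r * (1 / q - 1) * fubini_sum q k"
    by (simp add: algebra_simps)
  also have "r * (1 / q - 1) = 1" using r by (simp add: q_def field_simps)
  finally show ?thesis by (simp add: k_def)
qed

section \<open>Growth of the coefficients\<close>

lemma F_1: "F z 1 = 1"
  by (simp add: F_def)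

lemma F_inverse_rec:
  assumes "n > 1"
  shows "dirichlet_inverse (F z) n = z * (\<Sum>d | d dvd n \<and> d < n. dirichlet_inverse (F z) d)"
proof -
  have "(\<Sum>d | d dvd n \<and> d < n. F z (n div d) * dirichlet_inverse (F z) d)
      = (\<Sum>d | d dvd n \<and> d < n. - z * dirichlet_inverse (F z) d)"
    using assms by (intro sum.cong) (auto simp: F_def dvd_def)
  then show ?thesis using assms
    by (simp add: dirichlet_inverse_pos F_1[unfolded One_nat_def] dirichlet_unit_def
        sum_distrib_left sum_negf)
qed

text \<open>
  The bound satisfies with equality the recursion that the norms satisfy as an inequality.
  Allowing any \<open>r \<ge> norm z\<close> avoids a degenerate \<open>q = 0\<close> at \<open>z = 0\<close>.
\<close>
lemma norm_F_inverse_le: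
  fixes z :: complex
  assumes r: "r > 0" "norm z \<le> r" and n: "squarefree n"
  shows "norm (dirichlet_inverse (F z) n) \<le> fubini_sum (r / (1 + r)) (card (prime_factors n))"
  using n
proof (induction n rule: less_induct)
  case (less n)
  define q where "q = r / (1 + r)"
  have q: "0 \<le> q" "q < 1" using r by (auto simp: q_def field_simps)
  show ?case
  proof (cases "n = 1")
    case True
    have "fubini_sum q 0 = 1 + r" using r
      by (simp add: fubini_sum_0[OF q]) (simp add: q_def field_simps)
    then show ?thesis using r True dirichlet_inverse_1[of "F z"] F_1[of z]
      by (simp add: q_def)
  next
    case False
    then have n: "n > 1" using less.prems by (cases n) auto
    have "norm (dirichlet_inverse (F z) n)
        \<le> norm z * (\<Sum>d | d dvd n \<and> d < n. norm (dirichlet_inverse (F z) d))"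
      unfolding F_inverse_rec[OF n] norm_mult by (intro mult_left_mono norm_sum) simp
    also have "\<dots> \<le> r * (\<Sum>d | d dvd n \<and> d < n. fubini_sum q (card (prime_factors d)))"
      unfolding q_def
      by (intro mult_mono sum_mono less.IH sum_nonneg r)
         (use less.prems r in \<open>auto intro: squarefree_mono\<close>)
    also have "\<dots> = fubini_sum q (card (prime_factors n))"
      unfolding q_def by (rule fubini_sum_proper_divisors) (use r less.prems False in auto)
    finally show ?thesis by (simp add: q_def)
  qed
qed

section \<open>Convergence of the Fubini sums over squarefree numbers\<close>

text \<open>
  Expanding the product gives all sets of factors; the prime factors of the squarefree
  numbers up to \<open>N\<close> are some of these sets. Not restricting the factors to primes is harmless,
  because the series over all integers, to which the product is compared, converges.
\<close>
lemma sum_squarefree_le_prod: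
  fixes y :: "nat \<Rightarrow> real"
  assumes "\<And>p. y p \<ge> 0"
  shows "(\<Sum>n | n \<le> N \<and> squarefree n. \<Prod>p\<in>prime_factors n. y p) \<le> (\<Prod>p\<in>{..N}. 1 + y p)"
proof -
  have "(\<Sum>n | n \<le> N \<and> squarefree n. \<Prod>p\<in>prime_factors n. y p)
      = (\<Sum>S\<in>prime_factors ` {n. n \<le> N \<and> squarefree n}. \<Prod>p\<in>S. y p)"
    by (subst sum.reindex) (auto intro: inj_on_subset[OF inj_on_prime_factors_squarefree])
  also have "\<dots> \<le> (\<Sum>S\<in>Pow {..N}. \<Prod>p\<in>S. y p)"
  proof (rule sum_mono2)
    show "prime_factors ` {n. n \<le> N \<and> squarefree n} \<subseteq> Pow {..N}"
    proof safe
      fix n p assume "n \<le> N" "squarefree n" "p \<in> prime_factors n"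
      then show "p \<le> N"
        by (metis dvd_imp_le le_trans not_gr0 not_squarefree_0 prime_factors_dvd mem_Collect_eq in_prime_factors_imp_dvd)
    qed
  qed (auto intro: prod_nonneg assms)
  also have "\<dots> = (\<Prod>p\<in>{..N}. y p + 1)" by (subst prod_add) auto
  finally show ?thesis by (simp add: add.commute)
qed

text \<open>
  The finitely many factors with \<open>p < M\<close> grow only polynomially in \<open>m\<close>, and the exponential
  rate of the others is a tail of the series, hence as small as desired.
\<close>
lemma prod_one_plus_le:
  fixes x :: "nat \<Rightarrow> real"
  assumes x: "\<And>p. 0 \<le> x p" "\<And>p. x p \<le> 1" and s: "summable (\<lambda>p. x (p + M))"
  shows "(\<Prod>p\<in>{..N}. 1 + real m * x p) \<le> real (Suc m) ^ M * exp (real m * (\<Sum>p. x (p + M)))"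
proof -
  have ge1: "1 \<le> 1 + real m * x p" for p using x by simp
  have split: "(\<Prod>p<M + L. h p) = (\<Prod>p<M. h p) * (\<Prod>p<L. h (p + M))" for L and h :: "nat \<Rightarrow> real"
    by (induction L) (simp_all add: mult_ac add_ac)
  have "(\<Prod>p\<in>{..N}. 1 + real m * x p) \<le> (\<Prod>p<M + (N + 1). 1 + real m * x p)"
    by (rule prod_mono2) (use ge1 in \<open>auto intro: order_trans[OF zero_le_one]\<close>)
  also have "\<dots> = (\<Prod>p<M. 1 + real m * x p) * (\<Prod>p<N + 1. 1 + real m * x (p + M))"
    by (rule split)
  also have "\<dots> \<le> real (Suc m) ^ M * exp (real m * (\<Sum>p. x (p + M)))"
  proof (rule mult_mono)
    have "(\<Prod>p<M. 1 + real m * x p) \<le> (\<Prod>p<M. real (Suc m))"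
      using x by (intro prod_mono) (auto simp: mult_left_le)
    then show "(\<Prod>p<M. 1 + real m * x p) \<le> real (Suc m) ^ M" by simp
    have "(\<Prod>p<N + 1. 1 + real m * x (p + M)) \<le> (\<Prod>p<N + 1. exp (real m * x (p + M)))"
      using x by (intro prod_mono) (auto simp: exp_ge_add_one_self)
    also have "\<dots> = exp (real m * (\<Sum>p<N + 1. x (p + M)))"
      by (simp only: exp_sum[symmetric] finite_lessThan sum_distrib_left)
    also have "\<dots> \<le> exp (real m * (\<Sum>p. x (p + M)))"
      using sum_le_suminf[OF s, of "{..<N + 1}"] x by (simp add: mult_left_mono)
    finally show "(\<Prod>p<N + 1. 1 + real m * x (p + M)) \<le> exp (real m * (\<Sum>p. x (p + M)))" .
  qed (use x in \<open>auto intro!: prod_nonneg simp del: prod.lessThan_Suc\<close>)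
  finally show ?thesis .
qed

text \<open>
  After interchanging the summations, the coefficient of \<open>q\<^sup>m\<close> is at most
  \<open>(m + 1)\<^sup>M exp (m T)\<close> with a tail \<open>T\<close> of the series of \<open>p\<close> to the power \<open>- \<sigma>\<close>. Choosing \<open>M\<close> such that
  \<open>q exp T < 1\<close> bounds the partial sums.
\<close>
lemma summable_fubini_sum_squarefree:
  fixes \<sigma> q :: real
  assumes \<sigma>: "\<sigma> > 1" and q: "0 < q" "q < 1"
  shows "summable (\<lambda>k. (if squarefree (Suc k) then fubini_sum q (card (prime_factors (Suc k))) else 0)
    * real (Suc k) powr (- \<sigma>))"
proof -
  define x where "x p = real p powr (- \<sigma>)" for p
  have x: "0 \<le> x p" "x p \<le> 1" for p
  proof -
    show "0 \<le> x p" by (simp add: x_def)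
    show "x p \<le> 1" using \<sigma> powr_mono[of "- \<sigma>" 0 "real p"] by (cases "p = 0") (auto simp: x_def)
  qed
  have xs: "summable x" unfolding x_def using \<sigma> by (simp add: summable_real_powr_iff)
  have "(\<lambda>M. \<Sum>p. x (p + M)) \<longlonglongrightarrow> 0"
    by (rule suminf_exist_split2[OF xs])
  moreover have "- ln q > 0" using q by simp
  ultimately have "eventually (\<lambda>M. (\<Sum>p. x (p + M)) < - ln q) sequentially"
    by (rule order_tendstoD(2))
  then obtain M where M: "(\<Sum>p. x (p + M)) < - ln q"
    by (auto simp: eventually_sequentially)
  define T where "T = (\<Sum>p. x (p + M))"
  have "exp T < exp (- ln q)" using M by (simp add: T_def)
  then have \<rho>: "q * exp T < 1" using q by (simp add: exp_minus field_simps)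
  have tail: "summable (\<lambda>p. x (p + M))" using xs by (rule summable_ignore_initial_segment)
  have major: "summable (\<lambda>m. (q * exp T) ^ m * real (Suc m) ^ M)"
    by (rule summable_power_times_poly) (use q \<rho> in auto)
  have q': "0 \<le> q" "q < 1" using q by auto
  define b where "b n = (if squarefree n then fubini_sum q (card (prime_factors n)) else 0) * x n" for n
  have b: "b n \<ge> 0" for n using x fubini_sum_nonneg[OF q'] by (simp add: b_def)
  have "(\<Sum>k<N. b (Suc k)) \<le> (\<Sum>m. (q * exp T) ^ m * real (Suc m) ^ M)" for N
  proof -
    have "(\<Sum>k<N. b (Suc k)) = (\<Sum>n\<in>Suc ` {..<N}. b n)" by (simp add: sum.reindex)
    also have "\<dots> \<le> (\<Sum>n\<in>{..N}. b n)" by (rule sum_mono2) (use b in auto)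
    also have "\<dots> = (\<Sum>n | n \<le> N \<and> squarefree n. fubini_sum q (card (prime_factors n)) * x n)"
      by (rule sum.mono_neutral_cong_right) (auto simp: b_def)
    also have "\<dots> = (\<Sum>n | n \<le> N \<and> squarefree n. \<Sum>m. q ^ m * real m ^ card (prime_factors n) * x n)"
      unfolding fubini_sum_def by (intro sum.cong refl suminf_mult2 summable_fubini_sum q')
    also have "\<dots> = (\<Sum>m. \<Sum>n | n \<le> N \<and> squarefree n. q ^ m * real m ^ card (prime_factors n) * x n)"
      by (intro suminf_sum[symmetric] summable_mult2 summable_fubini_sum q')
    also have "\<dots> \<le> (\<Sum>m. (q * exp T) ^ m * real (Suc m) ^ M)"
    proof (rule suminf_le)
      show "summable (\<lambda>m. \<Sum>n | n \<le> N \<and> squarefree n. q ^ m * real m ^ card (prime_factors n) * x n)"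
        by (intro summable_sum summable_mult2 summable_fubini_sum q')
      fix m
      have xn: "real m ^ card (prime_factors n) * x n = (\<Prod>p\<in>prime_factors n. real m * x p)"
        if "squarefree n" for n
      proof -
        have "x n = x (\<Prod>(prime_factors n))" by (simp only: prod_prime_factors_squarefree[OF that])
        also have "\<dots> = (\<Prod>p\<in>prime_factors n. x p)"
          unfolding x_def by (simp add: prod_powr_distrib)
        finally show ?thesis by (simp add: prod.distrib)
      qed
      have "(\<Sum>n | n \<le> N \<and> squarefree n. q ^ m * real m ^ card (prime_factors n) * x n)
          = q ^ m * (\<Sum>n | n \<le> N \<and> squarefree n. \<Prod>p\<in>prime_factors n. real m * x p)"
        unfolding sum_distrib_left by (intro sum.cong refl) (simp add: xn mult.assoc)
      also have "\<dots> \<le> q ^ m * (real (Suc m) ^ M * exp (real m * T))"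
        unfolding T_def
        by (intro mult_left_mono order_trans[OF sum_squarefree_le_prod prod_one_plus_le[OF x tail]])
           (use x q in auto)
      also have "\<dots> = (q * exp T) ^ m * real (Suc m) ^ M"
        by (simp add: power_mult_distrib exp_of_nat_mult exp_of_nat2_mult mult_ac)
      finally show "(\<Sum>n | n \<le> N \<and> squarefree n. q ^ m * real m ^ card (prime_factors n) * x n)
          \<le> (q * exp T) ^ m * real (Suc m) ^ M" .
    qed (rule major)
    finally show ?thesis .
  qed
  then have "summable (\<lambda>k. b (Suc k))"
    by (intro summableI_nonneg_bounded b)
  then show ?thesis by (simp only: b_def x_def)
qed

lemma moebius_mu_square: "(moebius_mu n)\<^sup>2 = (if squarefree n then 1 else 0)"
  by (simp add: moebius_mu_def flip: power_mult)

lemma D_dagger_coeff_eq: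
  "D_dagger_coeff z n = (if squarefree n then dirichlet_inverse (F z) n else 0)"
  by (simp add: D_dagger_coeff_def moebius_mu_square)

lemma D_dagger_coeff_1: "D_dagger_coeff z 1 = 1"
  using dirichlet_inverse_1[of "F z"] by (simp add: D_dagger_coeff_eq F_def)

lemma D_dagger_abs_convergent: "abs_convergent_on_half_plane (D_dagger_coeff z)"
  unfolding abs_convergent_on_half_plane_def
proof (intro allI impI)
  fix \<sigma> :: real assume \<sigma>: "\<sigma> > 1"
  define r where "r = 1 + norm z"
  define q where "q = r / (1 + r)"
  have r: "r > 0" "norm z \<le> r" by (auto simp: r_def add_pos_nonneg)
  have q: "0 < q" "q < 1" using r by (auto simp: q_def field_simps)
  show "summable (\<lambda>k. norm (D_dagger_coeff z (Suc k)) * real (Suc k) powr (- \<sigma>))"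
  proof (rule summable_comparison_test'[OF summable_fubini_sum_squarefree[OF \<sigma> q], of 0])
    fix k
    have "norm (D_dagger_coeff z (Suc k))
        \<le> (if squarefree (Suc k) then fubini_sum q (card (prime_factors (Suc k))) else 0)"
      using norm_F_inverse_le[OF r] by (simp add: D_dagger_coeff_eq q_def)
    then have "norm (D_dagger_coeff z (Suc k)) * real (Suc k) powr (- \<sigma>)
        \<le> (if squarefree (Suc k) then fubini_sum q (card (prime_factors (Suc k))) else 0)
          * real (Suc k) powr (- \<sigma>)"
      by (rule mult_right_mono) simp
    then show "norm (norm (D_dagger_coeff z (Suc k)) * real (Suc k) powr (- \<sigma>))
        \<le> (if squarefree (Suc k) then fubini_sum q (card (prime_factors (Suc k))) else 0)
          * real (Suc k) powr (- \<sigma>)"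
      by (subst real_norm_def, subst abs_of_nonneg) simp_all
  qed
qed

section \<open>Multiplicativity\<close>

lemma D_dagger_coeff_prime:
  assumes "prime p"
  shows "D_dagger_coeff z p = z"
  using assms prime_gt_1_nat[OF assms] dirichlet_inverse_prime[of "F z" p] 
  by (simp add: D_dagger_coeff_eq squarefree_prime F_def)

text \<open>
  One factorization with a single factor, and two ordered ones with two factors.
\<close>
lemma D_dagger_coeff_prime_mult_prime:
  assumes "prime p" "prime q" "p \<noteq> q"
  shows "D_dagger_coeff z (p * q) = 2 * z\<^sup>2 + z"
proof -
  have pq: "p > 1" "q > 1" using assms prime_gt_1_nat by auto
  then have "p * q \<noteq> 1" "p * q \<noteq> 0" by auto
  moreover have "squarefree (p * q)"
    by (intro squarefree_mult_coprime primes_coprime squarefree_prime) (use assms in auto)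
  ultimately show ?thesis
    using assms pq dirichlet_inverse_prime_mult_prime[of "F z" p q]
    by (simp add: D_dagger_coeff_eq F_def power2_eq_square)
qed

text \<open>
  The value at \<open>6\<close> decides: there \<open>G z\<close> equals \<open>- z\<close>, whereas the product of its values at \<open>2\<close> and
  \<open>3\<close> is \<open>z\<^sup>2\<close>.
\<close>
lemma G_multiplicative_imp:
  assumes "is_multiplicative (G z)"
  shows "z = 0 \<or> z = -1"
proof -
  have pr: "prime (2::nat)" "prime (3::nat)" by simp_all
  have "G z (2 * 3) = G z 2 * G z 3"
    using assms primes_coprime[OF pr] unfolding is_multiplicative_def
    by (metis pr prime_gt_0_nat numeral_eq_iff num.distinct(5))
  moreover have "G z 2 = - z" "G z 3 = - z"
    using dirichlet_inverse_prime[of "D_dagger_coeff z"] D_dagger_coeff_1[of z] pr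
    by (simp_all add: G_def D_dagger_coeff_prime)
  moreover have "G z (2 * 3) = - z"
    using dirichlet_inverse_prime_mult_prime[of "D_dagger_coeff z", OF D_dagger_coeff_1 pr]
      D_dagger_coeff_prime_mult_prime[OF pr, of z] pr
    by (simp add: G_def D_dagger_coeff_prime power2_eq_square)
  ultimately have "z * (z + 1) = 0" by (simp add: algebra_simps)
  then show ?thesis by (auto simp: add_eq_0_iff2)
qed

section \<open>The two series with an Euler product\<close>

lemma dirichlet_inverse_unit: "dirichlet_inverse dirichlet_unit = dirichlet_unit"
proof (rule dirichlet_inverse_eqI)
  fix n :: nat assume "n > 0"
  then have "(\<Sum>d | d dvd n. dirichlet_unit (n div d) * (if d = 1 then 1 else 0)) = dirichlet_unit n"
    by (simp add: if_distrib[of "(*) _"] sum.delta cong: if_cong)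
  then show "(\<Sum>(a, b) | a * b = n. dirichlet_unit a * dirichlet_unit b) = dirichlet_unit n"
    unfolding sum_dirichlet_pairs[OF \<open>n > 0\<close>] dirichlet_unit_def by simp
qed (simp_all add: dirichlet_unit_def)

lemma D_dagger_coeff_0: "D_dagger_coeff 0 = dirichlet_unit"
proof -
  have "F 0 = dirichlet_unit" by (auto simp: F_def dirichlet_unit_def)
  then show ?thesis by (auto simp: D_dagger_coeff_eq dirichlet_inverse_unit dirichlet_unit_def)
qed

lemma G_0: "G 0 = dirichlet_unit"
  by (simp add: G_def D_dagger_coeff_0 dirichlet_inverse_unit)

lemma D_dagger_0: "D_dagger 0 s = 1"
proof -
  have "dirichlet_term dirichlet_unit s k = (if k = 0 then 1 else 0)" for k
    by (simp add: dirichlet_term_def dirichlet_unit_def)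
  then show ?thesis
    unfolding D_dagger_def D_dagger_coeff_0 dirichlet_sum_def
    using suminf_finite[of "{0}" "dirichlet_term dirichlet_unit s"] by simp
qed

lemma is_constant_one_D_0: "is_constant_one (D 0)"
  by (simp add: is_constant_one_def D_def G_0 D_dagger_0)

lemma dirichlet_inverse_F_minus_1: "dirichlet_inverse (F (- 1)) = moebius_mu"
proof (rule dirichlet_inverse_eqI)
  fix n :: nat assume n: "n > 0"
  have "(\<Sum>(a, b) | a * b = n. F (- 1) a * moebius_mu b)
      = (\<Sum>d | d dvd n. moebius_mu d)"
    unfolding sum_dirichlet_pairs[OF n] using n by (intro sum.cong) (auto simp: F_def)
  also have "\<dots> = (\<Sum>d | d dvd n \<and> squarefree d. (- 1) ^ card (prime_factors d))"
    using n by (intro sum.mono_neutral_cong_right) (auto simp: moebius_mu_def)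
  also have "\<dots> = (- 1 + 1) ^ card (prime_factors n)"
    by (rule sum_squarefree_divisors_power_card[OF n])
  also have "\<dots> = dirichlet_unit n"
    using n by (simp add: dirichlet_unit_def power_0_left prime_factorization_empty_iff)
  finally show "(\<Sum>(a, b) | a * b = n. F (- 1) a * moebius_mu b) = dirichlet_unit n" .
qed (simp_all add: F_def moebius_mu_def)

text \<open>
  At \<open>z = - 1\<close> the factor \<open>\<mu>\<^sup>2\<close> changes nothing, because the inverse of the constant function 1 is
  \<open>\<mu>\<close>, which is supported on the squarefree numbers.
\<close>
lemma D_dagger_coeff_minus_1: "D_dagger_coeff (- 1) = dirichlet_inverse (F (- 1))"
  by (auto simp: D_dagger_coeff_eq dirichlet_inverse_F_minus_1 moebius_mu_def)

lemma G_minus_1: "G (- 1) = F (- 1)"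
  unfolding G_def D_dagger_coeff_minus_1
  by (rule dirichlet_inverse_dirichlet_inverse) (simp_all add: F_def)

lemma F_minus_1_abs_convergent: "abs_convergent_on_half_plane (F (- 1))"
  unfolding abs_convergent_on_half_plane_def
proof (intro allI impI)
  fix \<sigma> :: real assume "\<sigma> > 1"
  then have "summable (\<lambda>k. real k powr (- \<sigma>))" by (simp add: summable_real_powr_iff)
  then show "summable (\<lambda>k. norm (F (- 1) (Suc k)) * real (Suc k) powr (- \<sigma>))"
    using summable_Suc_iff[of "\<lambda>k. real k powr (- \<sigma>)"] by (simp add: F_def)
qed

lemma inverse_D_dagger_minus_1:
  assumes "s \<in> half_plane"
  shows "inverse (D_dagger (- 1) s) = zeta s"
proof -
  have "dirichlet_sum (F (- 1)) s * D_dagger (- 1) s = 1"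
    unfolding D_dagger_def
  proof (rule dirichlet_sum_mult_inverse[OF F_minus_1_abs_convergent D_dagger_abs_convergent _ assms])
    show "(\<Sum>(a, b) | a * b = n. F (- 1) a * D_dagger_coeff (- 1) b) = dirichlet_unit n"
      if "n > 0" for n
      using that dirichlet_inverse_pos[of "F (- 1)" n] unfolding D_dagger_coeff_minus_1
      by (simp add: sum_dirichlet_pairs sum_divisors_split F_def)
  qed
  moreover have "dirichlet_sum (F (- 1)) = zeta"
    by (simp add: zeta_def dirichlet_sum_def dirichlet_term_def F_def fun_eq_iff cong: if_cong)
  ultimately show ?thesis by (simp add: inverse_unique mult.commute)
qed

lemma is_zeta_D_minus_1: "is_zeta (D (- 1))"
  by (simp add: is_zeta_def D_def G_minus_1 F_def inverse_D_dagger_minus_1)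

lemma has_euler_product_D_iff: "has_euler_product (D z) \<longleftrightarrow> z = 0 \<or> z = - 1"
proof
  assume "has_euler_product (D z)"
  then show "z = 0 \<or> z = - 1"
    using G_multiplicative_imp by (simp add: has_euler_product_def D_def)
next
  have "is_multiplicative (G 0)" "is_multiplicative (G (- 1))"
    by (auto simp: is_multiplicative_def G_0 G_minus_1 F_def dirichlet_unit_def)
  then show "z = 0 \<or> z = - 1 \<Longrightarrow> has_euler_product (D z)"
    by (auto simp: has_euler_product_def D_def)
qed

theorem mainTheorem4:
  shows "(\<exists>d\<in>D_family. is_zeta d)
    \<and> (\<forall>z. (\<forall>s\<in>half_plane. summable (dirichlet_term (D_dagger_coeff z) s))
          \<and> fun_of (D z) nicely_meromorphic_on half_plane
          \<and> (\<forall>s\<in>half_plane. \<not> is_pole (fun_of (D z)) s \<longrightarrow> fun_of (D z) s \<noteq> 0))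
    \<and> card {d \<in> D_family. has_euler_product d} = 2
    \<and> (\<exists>d\<in>D_family. has_euler_product d \<and> is_zeta d)
    \<and> (\<exists>d\<in>D_family. has_euler_product d \<and> is_constant_one d)
    \<and> (\<forall>d\<in>D_family. has_euler_product d \<longrightarrow> is_zeta d \<or> is_constant_one d)"
proof -
  have family: "D z \<in> D_family" for z by (simp add: D_family_def)
  have "D 0 \<noteq> D (- 1)"
  proof
    assume "D 0 = D (- 1)"
    then have "G 0 2 = G (- 1) 2" by (simp add: D_def)
    then show False by (simp add: G_0 G_minus_1 dirichlet_unit_def F_def)
  qed
  moreover have "{d \<in> D_family. has_euler_product d} = {D 0, D (- 1)}"
    by (auto simp: D_family_def has_euler_product_D_iff)
  ultimately have card: "card {d \<in> D_family. has_euler_product d} = 2" by simp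
  have c1: "D_dagger_coeff z 1 \<noteq> 0" for z by (simp add: D_dagger_coeff_1[unfolded One_nat_def])
  have fun_of: "fun_of (D z) = (\<lambda>s. inverse (dirichlet_sum (D_dagger_coeff z) s))" for z
    by (simp add: D_def D_dagger_def)
  have analytic: "(\<forall>s\<in>half_plane. summable (dirichlet_term (D_dagger_coeff z) s))
      \<and> fun_of (D z) nicely_meromorphic_on half_plane
      \<and> (\<forall>s\<in>half_plane. \<not> is_pole (fun_of (D z)) s \<longrightarrow> fun_of (D z) s \<noteq> 0)" for z
    unfolding fun_of
    using summable_dirichlet_term[OF D_dagger_abs_convergent]
      inverse_dirichlet_sum_meromorphic[OF D_dagger_abs_convergent c1] by blast
  show ?thesis
    using card analytic family is_zeta_D_minus_1 is_constant_one_D_0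
    by (auto simp: D_family_def has_euler_product_D_iff)
qed

end
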